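(* Let $N\in\mathbb N$ and $A(\theta)=2\sum_{\nu=1}^Na_\nu(1-\cos\nu\theta)$, where $a_1,\dots,a_N\in\mathbb R$ are determined by $\sum_{\nu=1}^Na_\nu\nu^2=1$ and $\sum_{\nu=1}^Na_\nu\nu^{2m}=0$ for $m=2,\dots,N$. Then (1) $A'(0)=A'(\pi)=0$ and $A'(\theta)>0$ for all $\theta\in(0,\pi)$; (2) $A(0)=0$ and $A(\theta)>0$ for all $\theta\in(0,\pi]$; (3) for every integer $K\ge N$, $A(\theta)=\theta^2-\sum_{n=N}^Kb_n\theta^{2n+2}+O(\theta^{2(K+2)})$ as $\theta\to0$, where $$b_n=\frac{2(-1)^{n+1}}{(2(n+1))!}\sum_{\nu=1}^Na_\nu\nu^{2(n+1)}.$$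
   Context: The linear system for $a_1,\dots,a_N$ is of Vandermonde type and has a unique solution. *)

theory Defs
  imports "HOL-Analysis.Analysis" "HOL-Library.Landau_Symbols"
begin

text \<open>Coefficients are a function on \<^typ>\<open>nat\<close>; only the values at \<open>1, \<dots>, N\<close> are used.\<close>

definition A_fun :: "nat \<Rightarrow> (nat \<Rightarrow> real) \<Rightarrow> real \<Rightarrow> real" where
  "A_fun N a \<theta> = 2 * (\<Sum>\<nu>=1..N. a \<nu> * (1 - cos (real \<nu> * \<theta>)))"

definition b_coeff :: "nat \<Rightarrow> (nat \<Rightarrow> real) \<Rightarrow> nat \<Rightarrow> real" where
  "b_coeff N a n =
     2 * (-1) ^ (n + 1) / fact (2 * (n + 1)) * (\<Sum>\<nu>=1..N. a \<nu> * real \<nu> ^ (2 * (n + 1)))"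

end

theory Submission
  imports Defs
begin

text \<open>
  Put \<open>s = sin\<^sup>2 (\<theta>/2)\<close>. The function \<open>A''(\<theta>) - 2\<close> is a cosine polynomial of degree at most \<open>N\<close>, hence a
  polynomial of degree at most \<open>N\<close> in \<open>s\<close>, and the moment conditions make it \<open>O(\<theta>\<^bsup>2N\<^esup>) = O(s\<^bsup>N\<^esup>)\<close> at
  \<open>0\<close>. Therefore \<open>A'' = 2 + c s\<^bsup>N\<^esup>\<close> for a constant \<open>c\<close>. As \<open>A'\<close> vanishes at \<open>0\<close> and \<open>\<pi>\<close>, \<open>A''\<close> has a
  zero in between, so \<open>c < 0\<close>. Thus \<open>A'\<close> is strictly concave on \<open>[0, \<pi>]\<close> with zero
  boundary values, which makes it positive inside.
\<close>

section \<open>Taylor expansion of cosine sums at 0\<close>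

lemma sum_cos_coeff_even:
  "(\<Sum>m<2 * M. cos_coeff m * x ^ m) = (\<Sum>m<M. (-1) ^ m / fact (2 * m) * x ^ (2 * m))"
  by (induction M) (simp_all add: cos_coeff_def)

text \<open>The Lagrange remainder of order \<open>2 * M\<close> has a coefficient of absolute value
  at most 1, so the error is at most \<open>\<bar>c * \<theta>\<bar> ^ (2 * M)\<close> for every
  \<theta>, not only near 0.\<close>

lemma cos_minus_taylor_bigo:
  fixes c :: real
  shows "(\<lambda>\<theta>. cos (c * \<theta>) - (\<Sum>m<M. (-1) ^ m / fact (2 * m) * (c * \<theta>) ^ (2 * m)))
           \<in> O[at 0](\<lambda>\<theta>. \<theta> ^ (2 * M))"
proof (rule bigoI[where c = "\<bar>c\<bar> ^ (2 * M)"], intro always_eventually allI)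
  fix \<theta> :: real
  obtain t where t: "cos (c * \<theta>) = (\<Sum>m<2 * M. cos_coeff m * (c * \<theta>) ^ m)
      + cos (t + 1 / 2 * real (2 * M) * pi) / fact (2 * M) * (c * \<theta>) ^ (2 * M)"
    using Maclaurin_cos_expansion[of "c * \<theta>" "2 * M"] by blast
  have "\<bar>cos (t + 1 / 2 * real (2 * M) * pi) / fact (2 * M)\<bar> \<le> 1"
    by (simp add: order_trans[OF abs_cos_le_one fact_ge_1])
  then have "\<bar>cos (t + 1 / 2 * real (2 * M) * pi) / fact (2 * M)\<bar> * \<bar>(c * \<theta>) ^ (2 * M)\<bar>
      \<le> 1 * \<bar>(c * \<theta>) ^ (2 * M)\<bar>"
    by (rule mult_right_mono) simp
  then show "norm (cos (c * \<theta>) - (\<Sum>m<M. (-1) ^ m / fact (2 * m) * (c * \<theta>) ^ (2 * m)))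
      \<le> \<bar>c\<bar> ^ (2 * M) * norm (\<theta> ^ (2 * M))"
    unfolding t sum_cos_coeff_even real_norm_def
    by (simp add: abs_mult power_abs power_mult_distrib)
qed

text \<open>Swapping the two finite sums expresses the Taylor coefficients through the even moments
  of \<open>c\<close>. This links moment conditions to vanishing at 0, and it also yields the error
  term of the final expansion.\<close>

lemma cos_sum_minus_taylor_bigo:
  fixes c :: "nat \<Rightarrow> real"
  shows "(\<lambda>\<theta>. (\<Sum>\<nu>\<in>S. c \<nu> * cos (real \<nu> * \<theta>))
            - (\<Sum>m<M. (-1) ^ m / fact (2 * m) * (\<Sum>\<nu>\<in>S. c \<nu> * real \<nu> ^ (2 * m)) * \<theta> ^ (2 * m)))
           \<in> O[at 0](\<lambda>\<theta>. \<theta> ^ (2 * M))"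
proof -
  have "(\<Sum>\<nu>\<in>S. c \<nu> * cos (real \<nu> * \<theta>))
      - (\<Sum>m<M. (-1) ^ m / fact (2 * m) * (\<Sum>\<nu>\<in>S. c \<nu> * real \<nu> ^ (2 * m)) * \<theta> ^ (2 * m))
      = (\<Sum>\<nu>\<in>S. c \<nu> * (cos (real \<nu> * \<theta>)
          - (\<Sum>m<M. (-1) ^ m / fact (2 * m) * (real \<nu> * \<theta>) ^ (2 * m))))" for \<theta> :: real
    by (simp add: right_diff_distrib sum_subtractf sum_distrib_left sum_distrib_right
        power_mult_distrib sum.swap[of _ S] mult_ac)
  moreover have "(\<lambda>\<theta>. \<Sum>\<nu>\<in>S. c \<nu> * (cos (real \<nu> * \<theta>)
          - (\<Sum>m<M. (-1) ^ m / fact (2 * m) * (real \<nu> * \<theta>) ^ (2 * m))))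
        \<in> O[at 0](\<lambda>\<theta>. \<theta> ^ (2 * M))"
    by (intro big_sum_in_bigo) (simp add: cos_minus_taylor_bigo del: times_divide_eq_left)
  ultimately show ?thesis by simp
qed

section \<open>Cosine sums as polynomials in the squared half-angle sine\<close>

lemma cos_eq_one_minus_sin_half: "cos \<theta> = 1 - 2 * sin (\<theta> / 2) ^ 2" for \<theta> :: real
  using cos_double_sin[of "\<theta> / 2"] by simp

text \<open>Chebyshev recurrence: the next cosine is \<open>2 * cos \<theta>\<close> times the
  current one minus the previous one, so each step raises the degree by at most 1.\<close>

lemma cos_multiple_eq_poly_sin_half:
  "\<exists>p :: real poly. degree p \<le> n \<and> (\<forall>\<theta>. cos (real n * \<theta>) = poly p (sin (\<theta> / 2) ^ 2))"
proof (induction n rule: induct_nat_012)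
  case 0
  show ?case by (rule exI[of _ 1]) simp
next
  case 1
  show ?case
    by (rule exI[of _ "[:1, -2:]"]) (simp add: cos_eq_one_minus_sin_half)
next
  case (ge2 n)
  then obtain p q :: "real poly"
    where p: "degree p \<le> n" "\<And>\<theta>. cos (real n * \<theta>) = poly p (sin (\<theta> / 2) ^ 2)"
      and q: "degree q \<le> Suc n" "\<And>\<theta>. cos (real (Suc n) * \<theta>) = poly q (sin (\<theta> / 2) ^ 2)"
    by blast
  show ?case
  \<comment> \<open>\<open>[:2, -4:]\<close> is \<open>2 * cos \<theta>\<close> written in s =
    \<open>sin (\<theta> / 2) ^ 2\<close>, namely 2 - 4s.\<close>
  proof (intro exI[of _ "[:2, -4:] * q - p"] conjI allI)
    have "degree ([:2, -4:] * q) \<le> Suc (Suc n)"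
      using degree_mult_le[of "[:2, -4:]" q] q(1) by simp
    then show "degree ([:2, -4:] * q - p) \<le> Suc (Suc n)"
      using p(1) by (intro degree_diff_le) auto
    fix \<theta> :: real
    have "cos (real (Suc (Suc n)) * \<theta>) = 2 * cos \<theta> * cos (real (Suc n) * \<theta>) - cos (real n * \<theta>)"
      using cos_add[of "real (Suc n) * \<theta>" \<theta>] cos_diff[of "real (Suc n) * \<theta>" \<theta>]
      by (simp add: algebra_simps)
    then show "cos (real (Suc (Suc n)) * \<theta>) = poly ([:2, -4:] * q - p) (sin (\<theta> / 2) ^ 2)"
      unfolding p(2) q(2) cos_eq_one_minus_sin_half[of \<theta>] by (simp add: algebra_simps)
  qed
qed

lemma cos_sum_eq_poly_sin_half:
  fixes c :: "nat \<Rightarrow> real"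
  obtains R :: "real poly" where "degree R \<le> N"
    and "\<And>\<theta>. (\<Sum>\<nu>\<le>N. c \<nu> * cos (real \<nu> * \<theta>)) = poly R (sin (\<theta> / 2) ^ 2)"
proof -
  obtain p :: "nat \<Rightarrow> real poly" where p: "\<And>n. degree (p n) \<le> n"
      "\<And>n \<theta>. cos (real n * \<theta>) = poly (p n) (sin (\<theta> / 2) ^ 2)"
    using cos_multiple_eq_poly_sin_half by metis
  show ?thesis
  proof (rule that[of "\<Sum>\<nu>\<le>N. smult (c \<nu>) (p \<nu>)"])
    show "degree (\<Sum>\<nu>\<le>N. smult (c \<nu>) (p \<nu>)) \<le> N"
      by (intro degree_sum_le) (auto intro: order_trans[OF degree_smult_le] order_trans[OF p(1)])
  qed (simp add: p(2) poly_sum)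
qed

text \<open>Since \<open>sin (\<theta> / 2) ^ 2\<close> behaves like
  \<open>\<theta> ^ 2 / 4\<close>, a zero of \<open>R\<close> of order j at 0 gives exact order 2j
  in \<theta>. The growth bound forces j to be at least \<open>N\<close>, and the degree bound
  leaves a single term.\<close>

lemma poly_sin_half_bigo_imp_monom:
  fixes R :: "real poly"
  assumes deg: "degree R \<le> N"
    and O: "(\<lambda>\<theta>. poly R (sin (\<theta> / 2) ^ 2)) \<in> O[at 0](\<lambda>\<theta>. \<theta> ^ (2 * N))"
  obtains c where "R = monom c N"
proof (cases "R = 0")
  case True
  then show ?thesis using that[of 0] by simp
next
  case False
  obtain q where q: "R = [:0, 1:] ^ order 0 R * q" "\<not> [:0, 1:] dvd q"
    using order_decomp[OF False, of 0] by auto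
  define j where "j = order 0 R"
  have q0: "poly q 0 \<noteq> 0"
    using q(2) by (simp add: dvd_iff_poly_eq_0)
  have R: "R = monom 1 j * q"
    using q(1) by (simp add: j_def monom_altdef)
  \<comment> \<open>If \<open>j < N\<close>, the quotient by \<open>\<theta> ^ (2 * j)\<close> tends
    to 0 by the growth bound, but, rescaled by \<open>4 ^ j\<close>, also to
    \<open>poly q 0\<close>, which is nonzero.\<close>
  have "\<not> j < N"
  proof
    assume "j < N"
    have "((\<lambda>\<theta>::real. sin (\<theta> / 2) / (\<theta> / 2)) \<longlongrightarrow> 1) (at 0)"
    proof -
      \<comment> \<open>The limit is read off as twice the derivative of
        \<open>sin (\<theta> / 2)\<close> at 0.\<close>
      have "((\<lambda>\<theta>. sin (\<theta> / 2)) has_real_derivative 1 / 2) (at 0)"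
        by (auto intro!: derivative_eq_intros)
      then have "((\<lambda>\<theta>. sin (\<theta> / 2) / \<theta>) \<longlongrightarrow> 1 / 2) (at (0::real))"
        by (simp add: DERIV_def)
      from tendsto_mult_left[OF this, of 2] show ?thesis
        by (simp add: mult.commute)
    qed
    then have sinc: "((\<lambda>\<theta>::real. (sin (\<theta> / 2) / (\<theta> / 2)) ^ (2 * j)) \<longlongrightarrow> 1) (at 0)"
      using tendsto_power[where n = "2 * j"] by fastforce
    have "((\<lambda>\<theta>. poly q (sin (\<theta> / 2) ^ 2)) \<longlongrightarrow> poly q 0) (at 0)"
      by (auto intro!: tendsto_eq_intros)
    from tendsto_mult[OF sinc this]
    have lim: "((\<lambda>\<theta>. (sin (\<theta> / 2) / (\<theta> / 2)) ^ (2 * j) * poly q (sin (\<theta> / 2) ^ 2))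
        \<longlongrightarrow> poly q 0) (at 0)"
      by simp
    have "(\<lambda>\<theta>. poly R (sin (\<theta> / 2) ^ 2)) \<in> o[at 0](\<lambda>\<theta>. \<theta> ^ (2 * j))"
    proof (rule landau_o.big_small_trans[OF O], rule smalloI_tendsto)
      have "((\<lambda>\<theta>::real. \<theta> ^ (2 * (N - j))) \<longlongrightarrow> 0) (at 0)"
        using \<open>j < N\<close> by (auto intro!: tendsto_eq_intros)
      moreover have "\<theta> ^ (2 * N) / \<theta> ^ (2 * j) = \<theta> ^ (2 * (N - j))" if "\<theta> \<noteq> 0" for \<theta> :: real
        using that \<open>j < N\<close> by (simp add: power_diff diff_mult_distrib2)
      ultimately show "((\<lambda>\<theta>::real. \<theta> ^ (2 * N) / \<theta> ^ (2 * j)) \<longlongrightarrow> 0) (at 0)"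
        by (subst tendsto_cong[where g = "\<lambda>\<theta>. \<theta> ^ (2 * (N - j))"])
           (simp_all add: eventually_at_filter)
      show "\<forall>\<^sub>F \<theta> in at 0. \<theta> ^ (2 * j) \<noteq> (0::real)"
        by (rule eventually_mono[OF eventually_neq_at_within[of 0]]) simp
    qed
    then have "((\<lambda>\<theta>. 4 ^ j * (poly R (sin (\<theta> / 2) ^ 2) / \<theta> ^ (2 * j))) \<longlongrightarrow> 4 ^ j * 0) (at 0)"
      by (intro tendsto_mult tendsto_const smalloD_tendsto)
    \<comment> \<open>The factor \<open>4 ^ j\<close> turns \<theta> into
      \<open>\<theta> / 2\<close> in the denominator. At 0 both sides are 0 for positive
      \<open>j\<close> (division by zero), and both are \<open>poly q 0\<close> for
      \<open>j = 0\<close>.\<close>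
    moreover have "4 ^ j * (poly R (sin (\<theta> / 2) ^ 2) / \<theta> ^ (2 * j))
        = (sin (\<theta> / 2) / (\<theta> / 2)) ^ (2 * j) * poly q (sin (\<theta> / 2) ^ 2)" for \<theta> :: real
      by (simp add: R poly_monom power_divide power_mult[of 2 2 j] flip: power_mult)
    ultimately show False
      using lim q0 tendsto_unique[of "at (0::real)"] by fastforce
  qed
  have "q \<noteq> 0" using q0 by auto
  then have "degree R = j + degree q"
    by (simp add: R degree_mult_eq degree_monom_eq)
  with deg \<open>\<not> j < N\<close> have "degree q = 0" "j = N" by auto
  then obtain c where "q = [:c:]" by (auto elim: degree_eq_zeroE)
  with R \<open>j = N\<close> have "R = monom c N" by (simp add: smult_monom)
  then show ?thesis by (rule that)
qed

text \<open>The vanishing moments remove every Taylor term below order \<open>2 * N\<close>, so the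
  polynomial in the squared half-angle sine must be a monomial of degree \<open>N\<close>.\<close>

lemma cos_sum_eq_sin_half_power:
  fixes c :: "nat \<Rightarrow> real"
  assumes "\<And>m. m < N \<Longrightarrow> (\<Sum>\<nu>\<le>N. c \<nu> * real \<nu> ^ (2 * m)) = 0"
  obtains d where "\<And>\<theta>. (\<Sum>\<nu>\<le>N. c \<nu> * cos (real \<nu> * \<theta>)) = d * sin (\<theta> / 2) ^ (2 * N)"
proof -
  obtain R :: "real poly" where R: "degree R \<le> N"
      "\<And>\<theta>. (\<Sum>\<nu>\<le>N. c \<nu> * cos (real \<nu> * \<theta>)) = poly R (sin (\<theta> / 2) ^ 2)"
    using cos_sum_eq_poly_sin_half by metis
  have "(\<lambda>\<theta>. poly R (sin (\<theta> / 2) ^ 2)) \<in> O[at 0](\<lambda>\<theta>. \<theta> ^ (2 * N))"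
    using cos_sum_minus_taylor_bigo[where S = "{..N}" and c = c and M = N] by (simp add: assms R(2))
  then obtain d where "R = monom d N"
    using poly_sin_half_bigo_imp_monom[OF R(1)] by blast
  then show ?thesis
    using that[of d] R(2) by (simp add: poly_monom power_mult)
qed

section \<open>Positivity of the derivative of A\<close>

text \<open>If \<open>f x\<close> were not positive, the mean value theorem would give a slope at
  most 0 left of \<open>x\<close> and a slope at least 0 right of it, although \<open>f'\<close>
  strictly decreases.\<close>

lemma positive_of_strict_concave:
  fixes f f' :: "real \<Rightarrow> real"
  assumes deriv: "\<And>x. (f has_real_derivative f' x) (at x)"
    and "f a = 0" "f b = 0" and x: "a < x" "x < b"
    and anti: "\<And>y z. \<lbrakk>a < y; y < z; z < b\<rbrakk> \<Longrightarrow> f' z < f' y"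
  shows "0 < f x"
proof -
  obtain y where y: "a < y" "y < x" "f x - f a = (x - a) * f' y"
    using MVT2[OF x(1)] deriv by blast
  obtain z where z: "x < z" "z < b" "f b - f x = (b - x) * f' z"
    using MVT2[OF x(2)] deriv by blast
  have "f' z < f' y"
    using anti y z by auto
  show ?thesis
  proof (rule ccontr)
    assume "\<not> 0 < f x"
    then have "(x - a) * f' y \<le> 0" "0 \<le> (b - x) * f' z"
      using y(3) z(3) \<open>f a = 0\<close> \<open>f b = 0\<close> by linarith+
    then have "f' y \<le> 0" "0 \<le> f' z"
      using x by (simp_all add: zero_le_mult_iff mult_le_0_iff)
    with \<open>f' z < f' y\<close> show False by linarith
  qed
qed

lemma A_fun_has_derivative:
  "(A_fun N a has_real_derivative 2 * (\<Sum>\<nu>=1..N. a \<nu> * real \<nu> * sin (real \<nu> * \<theta>))) (at \<theta>)"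
  unfolding A_fun_def [abs_def]
  by (auto intro!: derivative_eq_intros sum.cong simp: mult_ac)

lemma A_fun_derivative_has_derivative:
  "((\<lambda>\<theta>. 2 * (\<Sum>\<nu>=1..N. a \<nu> * real \<nu> * sin (real \<nu> * \<theta>))) has_real_derivative
     2 * (\<Sum>\<nu>=1..N. a \<nu> * real \<nu> ^ 2 * cos (real \<nu> * \<theta>))) (at \<theta>)"
  by (auto intro!: derivative_eq_intros sum.cong simp: mult_ac power2_eq_square)

lemma A_fun_second_derivative_eq:
  fixes a :: "nat \<Rightarrow> real"
  assumes sys1: "(\<Sum>\<nu>=1..N. a \<nu> * real \<nu> ^ 2) = 1"
    and sysm: "\<forall>m\<in>{2..N}. (\<Sum>\<nu>=1..N. a \<nu> * real \<nu> ^ (2 * m)) = 0"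
  obtains c where
    "\<And>\<theta>. 2 * (\<Sum>\<nu>=1..N. a \<nu> * real \<nu> ^ 2 * cos (real \<nu> * \<theta>)) = 2 + c * sin (\<theta> / 2) ^ (2 * N)"
proof -
  \<comment> \<open>The weights of A'' - 2 as a cosine sum: the constant -2 is the term of frequency
    0.\<close>
  define \<alpha> where "\<alpha> \<nu> = (if \<nu> = 0 then -2 else 2 * a \<nu> * real \<nu> ^ 2)" for \<nu>
  have split: "(\<Sum>\<nu>\<le>N. \<alpha> \<nu> * g \<nu>) = 2 * (\<Sum>\<nu>=1..N. a \<nu> * real \<nu> ^ 2 * g \<nu>) - 2 * g 0"
    for g :: "nat \<Rightarrow> real"
    by (simp add: atMost_atLeast0 sum.atLeast_Suc_atMost \<alpha>_def sum_distrib_left mult_ac)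
  have "(\<Sum>\<nu>\<le>N. \<alpha> \<nu> * real \<nu> ^ (2 * m)) = 0" if "m < N" for m
  proof (cases "m = 0")
    \<comment> \<open>Here \<open>0 ^ 0 = 1\<close>, so the frequency 0 term counts and cancels
      twice the sum in \<open>sys1\<close>.\<close>
    case True
    then show ?thesis using sys1 by (simp only: split) simp
  next
    \<comment> \<open>Now frequency 0 contributes nothing. The factor \<open>real \<nu> ^ 2\<close>
      shifts the moment index to \<open>Suc m\<close>, which lies in \<open>{2..N}\<close>.\<close>
    case False
    with that have "(\<Sum>\<nu>=1..N. a \<nu> * real \<nu> ^ (2 * Suc m)) = 0"
      by (intro bspec[OF sysm]) auto
    then have "(\<Sum>\<nu>=1..N. a \<nu> * real \<nu> ^ 2 * real \<nu> ^ (2 * m)) = 0"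
      by (simp add: power2_eq_square mult.assoc)
    with False show ?thesis by (simp only: split) simp
  qed
  then obtain c where "\<And>\<theta>. (\<Sum>\<nu>\<le>N. \<alpha> \<nu> * cos (real \<nu> * \<theta>)) = c * sin (\<theta> / 2) ^ (2 * N)"
    using cos_sum_eq_sin_half_power by blast
  then have "2 * (\<Sum>\<nu>=1..N. a \<nu> * real \<nu> ^ 2 * cos (real \<nu> * \<theta>)) - 2 = c * sin (\<theta> / 2) ^ (2 * N)"
    for \<theta>
    by (simp add: split)
  then show ?thesis
    by (intro that[of c]) (simp add: algebra_simps)
qed

lemma A_fun_derivative_pos:
  fixes a :: "nat \<Rightarrow> real"
  assumes sys1: "(\<Sum>\<nu>=1..N. a \<nu> * real \<nu> ^ 2) = 1"
    and sysm: "\<forall>m\<in>{2..N}. (\<Sum>\<nu>=1..N. a \<nu> * real \<nu> ^ (2 * m)) = 0"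
    and \<theta>: "0 < \<theta>" "\<theta> < pi"
  shows "2 * (\<Sum>\<nu>=1..N. a \<nu> * real \<nu> * sin (real \<nu> * \<theta>)) > 0"
proof -
  let ?f = "\<lambda>\<theta>. 2 * (\<Sum>\<nu>=1..N. a \<nu> * real \<nu> * sin (real \<nu> * \<theta>))"
  obtain c where c:
    "\<And>\<theta>. 2 * (\<Sum>\<nu>=1..N. a \<nu> * real \<nu> ^ 2 * cos (real \<nu> * \<theta>)) = 2 + c * sin (\<theta> / 2) ^ (2 * N)"
    using A_fun_second_derivative_eq[OF sys1 sysm] by blast
  \<comment> \<open>For \<open>N = 0\<close> the condition \<open>sys1\<close> would read 0 = 1. A
    positive exponent makes the sine power strictly monotone below.\<close>
  have "N > 0" using sys1 by (cases N) auto
  have deriv: "(?f has_real_derivative 2 + c * sin (x / 2) ^ (2 * N)) (at x)" for x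
    using A_fun_derivative_has_derivative[where a = a and N = N and \<theta> = x] unfolding c .
  have f0: "?f 0 = 0" and fpi: "?f pi = 0"
    by simp_all
  \<comment> \<open>Rolle's argument: A'' vanishes at \<open>z\<close>, so \<open>c\<close> must be
    negative.\<close>
  obtain z where "0 < z" "z < pi" and z: "?f pi - ?f 0 = (pi - 0) * (2 + c * sin (z / 2) ^ (2 * N))"
    using MVT2[of 0 pi ?f "\<lambda>x. 2 + c * sin (x / 2) ^ (2 * N)"] deriv pi_gt_zero by blast
  have "2 + c * sin (z / 2) ^ (2 * N) = 0"
    using z pi_gt_zero unfolding f0 fpi by simp
  moreover have "0 \<le> sin (z / 2) ^ (2 * N)"
    by simp
  ultimately have "c < 0"
    by (smt (verit) mult_nonneg_nonneg)
  \<comment> \<open>Half-angles stay below \<open>pi / 2\<close>, where sine increases; with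
    \<open>c < 0\<close> this makes A'' strictly decreasing.\<close>
  have "sin (x / 2) ^ (2 * N) < sin (y / 2) ^ (2 * N)" if "0 < x" "x < y" "y < pi" for x y
  proof (rule power_strict_mono)
    show "sin (x / 2) < sin (y / 2)"
      using that by (intro sin_monotone_2pi) auto
    show "0 \<le> sin (x / 2)"
      using that by (intro sin_ge_zero) auto
  qed (use \<open>N > 0\<close> in simp)
  then show ?thesis
    using \<open>c < 0\<close> by (intro positive_of_strict_concave[OF deriv f0 fpi \<theta>]) auto
qed

section \<open>Expansion of A at 0\<close>

text \<open>An exact identity that reduces the error to a Taylor remainder of cosines. Term 0
  cancels the constant part of A, term 1 gives \<open>\<theta> ^ 2\<close>, terms 2 to
  \<open>N\<close> vanish by \<open>sysm\<close>, and the later ones are the \<open>b_coeff\<close>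
  terms.\<close>

lemma A_fun_expansion_eq:
  fixes a :: "nat \<Rightarrow> real"
  assumes sys1: "(\<Sum>\<nu>=1..N. a \<nu> * real \<nu> ^ 2) = 1"
    and sysm: "\<forall>m\<in>{2..N}. (\<Sum>\<nu>=1..N. a \<nu> * real \<nu> ^ (2 * m)) = 0"
    and "N \<le> K"
  shows "A_fun N a \<theta> - (\<theta> ^ 2 - (\<Sum>n=N..K. b_coeff N a n * \<theta> ^ (2 * n + 2)))
    = - 2 * ((\<Sum>\<nu>=1..N. a \<nu> * cos (real \<nu> * \<theta>))
        - (\<Sum>m<K + 2. (-1) ^ m / fact (2 * m) * (\<Sum>\<nu>=1..N. a \<nu> * real \<nu> ^ (2 * m)) * \<theta> ^ (2 * m)))"
proof -
  define T where
    "T m = (-1) ^ m / fact (2 * m) * (\<Sum>\<nu>=1..N. a \<nu> * real \<nu> ^ (2 * m)) * \<theta> ^ (2 * m)" for m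
  have "N > 0" using sys1 by (cases N) auto
  have b: "b_coeff N a n * \<theta> ^ (2 * n + 2) = 2 * T (Suc n)" for n
    by (simp add: b_coeff_def T_def)
  have T0: "T 0 = (\<Sum>\<nu>=1..N. a \<nu>)" and T1: "T 1 = - (\<theta> ^ 2 / 2)"
    using sys1 by (simp_all add: T_def fact_numeral)
  have "T (Suc n) = 0" if "n \<in> {1..<N}" for n
    unfolding T_def by (subst bspec[OF sysm]) (use that in auto)
  then have "(\<Sum>n=1..<N. T (Suc n)) = 0" by simp
  moreover have "(\<Sum>n=1..<N. T (Suc n)) + (\<Sum>n=N..<Suc K. T (Suc n)) = (\<Sum>n=1..<Suc K. T (Suc n))"
    using \<open>N > 0\<close> \<open>N \<le> K\<close> by (intro sum.atLeastLessThan_concat) auto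
  \<comment> \<open>The last Taylor index is \<open>K + 1\<close>, since
    \<open>b_coeff N a K\<close> belongs to the power \<open>2 * K + 2\<close>.\<close>
  moreover have "(\<Sum>m<K + 2. T m) = T 0 + T 1 + (\<Sum>n=1..<Suc K. T (Suc n))"
    by (simp add: lessThan_atLeast0 sum.atLeast_Suc_lessThan sum.shift_bounds_Suc_ivl
        del: sum.op_ivl_Suc)
  ultimately have "(\<Sum>m<K + 2. T m) = (\<Sum>\<nu>=1..N. a \<nu>) - \<theta> ^ 2 / 2 + (\<Sum>n=N..K. T (Suc n))"
    by (simp add: T0 T1[unfolded One_nat_def] atLeastLessThanSuc_atLeastAtMost del: sum.op_ivl_Suc)
  moreover have "A_fun N a \<theta> = 2 * ((\<Sum>\<nu>=1..N. a \<nu>) - (\<Sum>\<nu>=1..N. a \<nu> * cos (real \<nu> * \<theta>)))"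
    by (simp add: A_fun_def right_diff_distrib sum_subtractf)
  ultimately show ?thesis
    unfolding b T_def[symmetric] sum_distrib_left[symmetric] by argo
qed

theorem lemma6p2:
  fixes N :: nat and a :: "nat \<Rightarrow> real"
  assumes sys1: "(\<Sum>\<nu>=1..N. a \<nu> * real \<nu> ^ 2) = 1"
    and sysm: "\<forall>m\<in>{2..N}. (\<Sum>\<nu>=1..N. a \<nu> * real \<nu> ^ (2 * m)) = 0"
  shows "(deriv (A_fun N a) 0 = 0 \<and> deriv (A_fun N a) pi = 0 \<and>
           (\<forall>\<theta>\<in>{0<..<pi}. deriv (A_fun N a) \<theta> > 0)) \<and>
         (A_fun N a 0 = 0 \<and> (\<forall>\<theta>\<in>{0<..pi}. A_fun N a \<theta> > 0)) \<and>
         (\<forall>K\<ge>N. (\<lambda>\<theta>. A_fun N a \<theta> - (\<theta> ^ 2 - (\<Sum>n=N..K. b_coeff N a n * \<theta> ^ (2 * n + 2))))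
                  \<in> O[at 0](\<lambda>\<theta>. \<theta> ^ (2 * (K + 2))))"
proof (intro conjI ballI allI impI)
  have deriv: "deriv (A_fun N a) \<theta> = 2 * (\<Sum>\<nu>=1..N. a \<nu> * real \<nu> * sin (real \<nu> * \<theta>))" for \<theta>
    using A_fun_has_derivative by (rule DERIV_imp_deriv)
  show "deriv (A_fun N a) 0 = 0" "deriv (A_fun N a) pi = 0"
    unfolding deriv by simp_all
  show "deriv (A_fun N a) \<theta> > 0" if "\<theta> \<in> {0<..<pi}" for \<theta>
    unfolding deriv using A_fun_derivative_pos[OF sys1 sysm] that by simp
  show A0: "A_fun N a 0 = 0"
    by (simp add: A_fun_def)
  show "A_fun N a \<theta> > 0" if "\<theta> \<in> {0<..pi}" for \<theta>
  proof -
    have "A_fun N a 0 < A_fun N a \<theta>"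
    \<comment> \<open>A positive derivative on the open interval suffices, so
      \<open>\<theta> = pi\<close>, where A' vanishes, is covered.\<close>
    proof (rule DERIV_pos_imp_increasing_open[where f = "A_fun N a"])
      show "continuous_on {0..\<theta>} (A_fun N a)"
        by (rule DERIV_continuous_on, rule has_field_derivative_at_within, rule A_fun_has_derivative)
      show "0 < \<theta>"
        using that by simp
      show "\<exists>y. (A_fun N a has_real_derivative y) (at x) \<and> 0 < y" if "0 < x" "x < \<theta>" for x
        using A_fun_has_derivative A_fun_derivative_pos[OF sys1 sysm, of x]
          \<open>\<theta> \<in> {0<..pi}\<close> that by fastforce
    qed
    with A0 show ?thesis by simp
  qed
  fix K assume "N \<le> K"
  show "(\<lambda>\<theta>. A_fun N a \<theta> - (\<theta> ^ 2 - (\<Sum>n=N..K. b_coeff N a n * \<theta> ^ (2 * n + 2))))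
      \<in> O[at 0](\<lambda>\<theta>. \<theta> ^ (2 * (K + 2)))"
    unfolding A_fun_expansion_eq[OF sys1 sysm \<open>N \<le> K\<close>]
    by (rule landau_o.big.cmult_in_iff[THEN iffD2]) (simp, rule cos_sum_minus_taylor_bigo)
qed

end
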